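(* Let $(\rho,V)$ be an irreducible finite-dimensional complex representation of $\mathcal{LB}_3$ with $\rho(s_1s_2)=I$, $A:=\rho(\sigma_1)=\rho(\sigma_2)$, and $\dim V>1$. Then $V$ is $2$-dimensional, and in a suitable basis it is of the form $$A=\begin{pmatrix}\lambda&x\\0&-\lambda\end{pmatrix},\qquad \rho(s_1)=\rho(s_2)=\begin{pmatrix}0&1\\1&0\end{pmatrix},$$ for some $x\in\mathbb{C}$ and $\lambda\in\mathbb{C}^\times$. No two of these representations (for distinct parameters $(\lambda,x)$) are isomorphic.
   Context: The three component loop braid group $\mathcal{LB}_3$ is the group generated by $\sigma_1,\sigma_2,s_1,s_2$ with relations $\sigma_1\sigma_2\sigma_1=\sigma_2\sigma_1\sigma_2$; $s_1s_2s_1=s_2s_1s_2$; $s_1^2=s_2^2=1$; $s_1s_2\sigma_1=\sigma_2s_1s_2$; $\sigma_1\sigma_2s_1=s_2\sigma_1\sigma_2$.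
   Formalization: Non-isomorphism is proved only for parameters distinct up to the sign of λ: the pairs (λ,x) and (−λ,x) are excluded, because they give isomorphic representations whenever x ≠ ±2λ, i.e. whenever these are irreducible, so the last sentence is false as written. *)

theory Defs
  imports "HOL-Analysis.Analysis" "HOL-Algebra.Group"
begin

section \<open>Groups given by generators and relations\<close>

text \<open>Words in the generators and their formal inverses: \<open>(a, False)\<close> is the
  generator \<open>a\<close> and \<open>(a, True)\<close> its formal inverse.\<close>

type_synonym 'a word = "('a \<times> bool) list"

text \<open>The least congruence on words that contains the pairs in \<open>R\<close> and cancels
  \<open>a a\<inverse>\<close> and \<open>a\<inverse> a\<close>.\<close>

inductive word_cong :: "('a word \<times> 'a word) set \<Rightarrow> 'a word \<Rightarrow> 'a word \<Rightarrow> bool"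
  for R :: "('a word \<times> 'a word) set" where
  refl: "word_cong R u u"
| sym: "word_cong R u v \<Longrightarrow> word_cong R v u"
| trans: "word_cong R u v \<Longrightarrow> word_cong R v w \<Longrightarrow> word_cong R u w"
| rel: "(l, r) \<in> R \<Longrightarrow> word_cong R (u @ l @ v) (u @ r @ v)"
| cancel: "word_cong R (u @ [(a, e), (a, \<not> e)] @ v) (u @ v)"

definition word_class :: "('a word \<times> 'a word) set \<Rightarrow> 'a word \<Rightarrow> 'a word set" where
  "word_class R u = {v. word_cong R u v}"

definition presented_group :: "('a word \<times> 'a word) set \<Rightarrow> 'a word set monoid" where
  "presented_group R =
     \<lparr>carrier = range (word_class R),
      mult = (\<lambda>X Y. {w. \<exists>x\<in>X. \<exists>y\<in>Y. word_cong R (x @ y) w}),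
      one = word_class R []\<rparr>"

lemma word_cong_append:
  assumes "word_cong R u u'" "word_cong R v v'"
  shows "word_cong R (u @ v) (u' @ v')"
proof -
  have 1: "word_cong R (p @ x @ q) (p @ y @ q)" if "word_cong R x y" for p q x y
    using that
  proof (induction rule: word_cong.induct)
    case (rel l r u v)
    then show ?case using word_cong.rel[of l r R "p @ u" "v @ q"] by simp
  next
    case (cancel u a e v)
    then show ?case using word_cong.cancel[of R "p @ u" a e "v @ q"] by simp
  qed (blast intro: word_cong.intros)+
  show ?thesis
    using 1[OF assms(1), of "[]" v] 1[OF assms(2), of u' "[]"]
    by (auto intro: word_cong.trans)
qed

lemma word_class_eq_iff: "word_class R u = word_class R v \<longleftrightarrow> word_cong R u v"
  unfolding word_class_def by (auto intro: word_cong.intros)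

lemma presented_group_mult:
  "word_class R u \<otimes>\<^bsub>presented_group R\<^esub> word_class R v = word_class R (u @ v)"
  unfolding presented_group_def word_class_def
  by (auto intro: word_cong.intros word_cong_append)

lemma word_cong_inverse: "word_cong R (map (\<lambda>(a, e). (a, \<not> e)) (rev w) @ w) []"
proof (induction w)
  case (Cons p w)
  obtain a e where p: "p = (a, e)" by (cases p)
  let ?i = "map (\<lambda>(a, e). (a, \<not> e)) (rev w)"
  have "word_cong R (?i @ [(a, \<not> e), (a, \<not> \<not> e)] @ w) (?i @ w)"
    by (rule word_cong.cancel)
  then show ?case using Cons p by (auto intro: word_cong.trans)
qed (auto intro: word_cong.intros)

lemma group_presented_group: "group (presented_group R)"
proof (rule groupI)
  have one: "\<one>\<^bsub>presented_group R\<^esub> = word_class R []"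
    by (simp add: presented_group_def)
  have car: "carrier (presented_group R) = range (word_class R)"
    by (simp add: presented_group_def)
  show "\<one>\<^bsub>presented_group R\<^esub> \<in> carrier (presented_group R)"
    by (simp add: one car)
  fix x y z
  assume "x \<in> carrier (presented_group R)"
  then obtain u where u: "x = word_class R u" by (auto simp: car)
  show "\<one>\<^bsub>presented_group R\<^esub> \<otimes>\<^bsub>presented_group R\<^esub> x = x"
    by (simp add: u one presented_group_mult)
  show "\<exists>y\<in>carrier (presented_group R). y \<otimes>\<^bsub>presented_group R\<^esub> x = \<one>\<^bsub>presented_group R\<^esub>"
    using word_cong_inverse[of R u]
    by (auto simp: u one car presented_group_mult word_class_eq_iff)
  assume "y \<in> carrier (presented_group R)"
  then obtain v where v: "y = word_class R v" by (auto simp: car)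
  show "x \<otimes>\<^bsub>presented_group R\<^esub> y \<in> carrier (presented_group R)"
    by (simp add: u v car presented_group_mult)
  assume "z \<in> carrier (presented_group R)"
  then obtain w where w: "z = word_class R w" by (auto simp: car)
  show "x \<otimes>\<^bsub>presented_group R\<^esub> y \<otimes>\<^bsub>presented_group R\<^esub> z =
        x \<otimes>\<^bsub>presented_group R\<^esub> (y \<otimes>\<^bsub>presented_group R\<^esub> z)"
    by (simp add: u v w presented_group_mult)
qed

text \<open>The map on \<open>presented_group R\<close> induced by a map \<open>\<phi>\<close> from the generators to a
  group \<open>H\<close>; by \<open>presented_lift\<close> below it is the homomorphism extending \<open>\<phi>\<close> if \<open>\<phi>\<close>
  respects the relations, and it has no meaning otherwise.\<close>

definition eval_word :: "('b, 'c) monoid_scheme \<Rightarrow> ('a \<Rightarrow> 'b) \<Rightarrow> 'a word \<Rightarrow> 'b" where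
  "eval_word H \<phi> w =
     foldr (\<lambda>(a, e) y. (if e then inv\<^bsub>H\<^esub> (\<phi> a) else \<phi> a) \<otimes>\<^bsub>H\<^esub> y) w \<one>\<^bsub>H\<^esub>"

definition presented_lift :: "('b, 'c) monoid_scheme \<Rightarrow> ('a \<Rightarrow> 'b) \<Rightarrow> 'a word set \<Rightarrow> 'b" where
  "presented_lift H \<phi> X = eval_word H \<phi> (SOME w. w \<in> X)"

lemma eval_word_closed:
  assumes "group H" "\<And>a. \<phi> a \<in> carrier H"
  shows "eval_word H \<phi> w \<in> carrier H"
proof -
  interpret group H by fact
  show ?thesis
    by (induction w) (auto simp: eval_word_def assms(2))
qed

lemma eval_word_append:
  assumes "group H" "\<And>a. \<phi> a \<in> carrier H"
  shows "eval_word H \<phi> (u @ v) = eval_word H \<phi> u \<otimes>\<^bsub>H\<^esub> eval_word H \<phi> v"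
proof -
  interpret group H by fact
  have c: "foldr (\<lambda>(a, e) y. (if e then inv\<^bsub>H\<^esub> (\<phi> a) else \<phi> a) \<otimes>\<^bsub>H\<^esub> y) w \<one>\<^bsub>H\<^esub> \<in> carrier H" for w
    using eval_word_closed[OF assms, where w = w] by (simp add: eval_word_def)
  show ?thesis
    by (induction u) (auto simp: eval_word_def assms(2) c m_assoc)
qed

lemma presented_lift_word_class:
  assumes H: "group H" and \<phi>: "\<And>a. \<phi> a \<in> carrier H"
    and R: "\<And>l r. (l, r) \<in> R \<Longrightarrow> eval_word H \<phi> l = eval_word H \<phi> r"
  shows "presented_lift H \<phi> (word_class R w) = eval_word H \<phi> w"
proof -
  interpret group H by fact
  have "eval_word H \<phi> u = eval_word H \<phi> v" if "word_cong R u v" for u v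
    using that
  proof (induction rule: word_cong.induct)
    case (rel l r u v)
    then show ?case by (simp add: eval_word_append[OF H \<phi>] R)
  next
    case (cancel u a e v)
    have "eval_word H \<phi> [(a, e), (a, \<not> e)] = \<one>\<^bsub>H\<^esub>"
      by (auto simp: eval_word_def \<phi>)
    then show ?case
      by (simp only: eval_word_append[OF H \<phi>]) (simp add: eval_word_closed[OF H \<phi>])
  qed auto
  moreover have "word_cong R w (SOME v. v \<in> word_class R w)"
    by (rule someI2[of "\<lambda>v. v \<in> word_class R w" w])
      (auto simp: word_class_def intro: word_cong.refl)
  ultimately show ?thesis by (auto simp: presented_lift_def)
qed

lemma presented_lift:
  assumes H: "group H" and \<phi>: "\<And>a. \<phi> a \<in> carrier H"
    and R: "\<And>l r. (l, r) \<in> R \<Longrightarrow> eval_word H \<phi> l = eval_word H \<phi> r"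
  shows "presented_lift H \<phi> \<in> hom (presented_group R) H"
    and "presented_lift H \<phi> (word_class R [(a, False)]) = \<phi> a"
proof -
  interpret group H by fact
  note lift = presented_lift_word_class[OF H \<phi> R]
  show "presented_lift H \<phi> \<in> hom (presented_group R) H"
  proof (rule homI)
    fix X assume "X \<in> carrier (presented_group R)"
    then obtain u where u: "X = word_class R u" by (auto simp: presented_group_def)
    show "presented_lift H \<phi> X \<in> carrier H"
      by (simp add: u lift eval_word_closed[OF H \<phi>])
    fix Y assume "Y \<in> carrier (presented_group R)"
    then obtain v where v: "Y = word_class R v" by (auto simp: presented_group_def)
    show "presented_lift H \<phi> (X \<otimes>\<^bsub>presented_group R\<^esub> Y) =
          presented_lift H \<phi> X \<otimes>\<^bsub>H\<^esub> presented_lift H \<phi> Y"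
      by (simp add: u v lift presented_group_mult eval_word_append[OF H \<phi>])
  qed
  show "presented_lift H \<phi> (word_class R [(a, False)]) = \<phi> a"
    by (simp add: lift) (simp add: eval_word_def \<phi>)
qed


section \<open>The three component loop braid group\<close>

datatype LB3_gen = Sigma1 | Sigma2 | S1 | S2

abbreviation gen_word :: "'a list \<Rightarrow> 'a word" where
  "gen_word as \<equiv> map (\<lambda>a. (a, False)) as"

definition LB3_relations :: "(LB3_gen word \<times> LB3_gen word) set" where
  "LB3_relations =
     {(gen_word [Sigma1, Sigma2, Sigma1], gen_word [Sigma2, Sigma1, Sigma2]),
      (gen_word [S1, S2, S1], gen_word [S2, S1, S2]),
      (gen_word [S1, S1], []),
      (gen_word [S2, S2], []),
      (gen_word [S1, S2, Sigma1], gen_word [Sigma2, S1, S2]),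
      (gen_word [Sigma1, Sigma2, S1], gen_word [S2, Sigma1, Sigma2])}"

definition LB3 :: "LB3_gen word set monoid" where
  "LB3 = presented_group LB3_relations"

definition LB3_elem :: "LB3_gen \<Rightarrow> LB3_gen word set" where
  "LB3_elem a = word_class LB3_relations [(a, False)]"

abbreviation "\<sigma>\<^sub>1 \<equiv> LB3_elem Sigma1"
abbreviation "\<sigma>\<^sub>2 \<equiv> LB3_elem Sigma2"
abbreviation "s\<^sub>1 \<equiv> LB3_elem S1"
abbreviation "s\<^sub>2 \<equiv> LB3_elem S2"


section \<open>Finite-dimensional representations\<close>

text \<open>As in \<^theory>\<open>HOL.Vector_Spaces\<close>, the underlying space is a whole type \<open>'v\<close>,
  with scalar multiplication \<open>smul\<close>.\<close>

definition GL :: "('k::field \<Rightarrow> 'v::ab_group_add \<Rightarrow> 'v) \<Rightarrow> ('v \<Rightarrow> 'v) monoid" where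
  "GL smul = \<lparr>carrier = {f. Vector_Spaces.linear smul smul f \<and> bij f}, mult = (\<circ>), one = id\<rparr>"

definition fd_representation ::
  "('g, 'm) monoid_scheme \<Rightarrow> ('k::field \<Rightarrow> 'v::ab_group_add \<Rightarrow> 'v) \<Rightarrow> ('g \<Rightarrow> 'v \<Rightarrow> 'v) \<Rightarrow> bool" where
  "fd_representation G smul \<rho> \<longleftrightarrow>
     (\<exists>B. finite_dimensional_vector_space smul B) \<and> \<rho> \<in> hom G (GL smul)"

definition irreducible_rep ::
  "('g, 'm) monoid_scheme \<Rightarrow> ('k::field \<Rightarrow> 'v::ab_group_add \<Rightarrow> 'v) \<Rightarrow> ('g \<Rightarrow> 'v \<Rightarrow> 'v) \<Rightarrow> bool" where
  "irreducible_rep G smul \<rho> \<longleftrightarrow>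
     (UNIV :: 'v set) \<noteq> {0} \<and>
     (\<forall>W. module.subspace smul W \<longrightarrow> (\<forall>g\<in>carrier G. \<rho> g ` W \<subseteq> W) \<longrightarrow> W = {0} \<or> W = UNIV)"

definition isomorphic_reps ::
  "('g, 'm) monoid_scheme \<Rightarrow> ('k::field \<Rightarrow> 'v::ab_group_add \<Rightarrow> 'v) \<Rightarrow> ('g \<Rightarrow> 'v \<Rightarrow> 'v)
     \<Rightarrow> ('k \<Rightarrow> 'w::ab_group_add \<Rightarrow> 'w) \<Rightarrow> ('g \<Rightarrow> 'w \<Rightarrow> 'w) \<Rightarrow> bool" where
  "isomorphic_reps G smul1 \<rho>1 smul2 \<rho>2 \<longleftrightarrow>
     (\<exists>T. Vector_Spaces.linear smul1 smul2 T \<and> bij T \<and>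
          (\<forall>g\<in>carrier G. T \<circ> \<rho>1 g = \<rho>2 g \<circ> T))"

definition ordered_basis ::
  "('k::field \<Rightarrow> 'v::ab_group_add \<Rightarrow> 'v) \<Rightarrow> ('n::finite \<Rightarrow> 'v) \<Rightarrow> bool" where
  "ordered_basis smul b \<longleftrightarrow>
     inj b \<and> \<not> module.dependent smul (range b) \<and> module.span smul (range b) = UNIV"

definition has_matrix ::
  "('k::field \<Rightarrow> 'v::ab_group_add \<Rightarrow> 'v) \<Rightarrow> ('n::finite \<Rightarrow> 'v) \<Rightarrow> ('v \<Rightarrow> 'v) \<Rightarrow> 'k^'n^'n \<Rightarrow> bool" where
  "has_matrix smul b f M \<longleftrightarrow> (\<forall>j. f (b j) = (\<Sum>i\<in>UNIV. smul (M $ i $ j) (b i)))"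


section \<open>The two-dimensional matrix representations\<close>

definition sigma_mat :: "complex \<Rightarrow> complex \<Rightarrow> complex^2^2" where
  "sigma_mat \<kappa> x = vector [vector [\<kappa>, x], vector [0, - \<kappa>]]"

definition swap_mat :: "complex^2^2" where
  "swap_mat = vector [vector [0, 1], vector [1, 0]]"

fun gen_mat :: "complex \<Rightarrow> complex \<Rightarrow> LB3_gen \<Rightarrow> complex^2^2" where
  "gen_mat \<kappa> x Sigma1 = sigma_mat \<kappa> x"
| "gen_mat \<kappa> x Sigma2 = sigma_mat \<kappa> x"
| "gen_mat \<kappa> x S1 = swap_mat"
| "gen_mat \<kappa> x S2 = swap_mat"

definition LB3_mat_rep :: "complex \<Rightarrow> complex \<Rightarrow> LB3_gen word set \<Rightarrow> complex^2 \<Rightarrow> complex^2" where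
  "LB3_mat_rep \<kappa> x = presented_lift (GL (*s)) (\<lambda>a. (*v) (gen_mat \<kappa> x a))"

lemma group_GL:
  assumes "vector_space smul"
  shows "group (GL smul)"
proof (rule groupI)
  interpret vector_space smul by fact
  interpret vector_space_pair smul smul ..
  show "\<one>\<^bsub>GL smul\<^esub> \<in> carrier (GL smul)"
    using linear_id by (simp add: GL_def)
  fix f g
  assume f: "f \<in> carrier (GL smul)"
  show "\<one>\<^bsub>GL smul\<^esub> \<otimes>\<^bsub>GL smul\<^esub> f = f" by (simp add: GL_def)
  have "Vector_Spaces.linear smul smul (the_inv f)" "bij (the_inv f)" "the_inv f \<circ> f = id"
    if "Vector_Spaces.linear smul smul f" "bij f"
  proof -
    interpret f: Vector_Spaces.linear smul smul f by fact
    note * = the_inv_f_f[OF bij_is_inj[OF that(2)]] f_the_inv_into_f_bij_betw[OF that(2)]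
    show "the_inv f \<circ> f = id" by (auto simp: *)
    show "bij (the_inv f)" using that(2) by (rule bij_betw_the_inv_into)
    show "Vector_Spaces.linear smul smul (the_inv f)"
    proof (rule Vector_Spaces.linear.intro[OF assms assms], unfold_locales)
      show "the_inv f (a + b) = the_inv f a + the_inv f b" for a b
        by (metis * UNIV_I f.add)
      show "the_inv f (smul r b) = smul r (the_inv f b)" for r b
        by (metis * UNIV_I f.scale)
    qed
  qed
  then show "\<exists>g\<in>carrier (GL smul). g \<otimes>\<^bsub>GL smul\<^esub> f = \<one>\<^bsub>GL smul\<^esub>"
    using f by (auto simp: GL_def intro!: bexI[of _ "the_inv f"])
  assume g: "g \<in> carrier (GL smul)"
  show "f \<otimes>\<^bsub>GL smul\<^esub> g \<in> carrier (GL smul)"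
    using f g by (auto simp: GL_def intro: bij_comp Vector_Spaces.linear_compose)
  show "f \<otimes>\<^bsub>GL smul\<^esub> g \<otimes>\<^bsub>GL smul\<^esub> h = f \<otimes>\<^bsub>GL smul\<^esub> (g \<otimes>\<^bsub>GL smul\<^esub> h)" for h
    by (simp add: GL_def comp_assoc)
qed

lemma mat_in_GL:
  fixes M :: "complex^2^2"
  assumes "det M \<noteq> 0"
  shows "(*v) M \<in> carrier (GL (*s))"
  using assms by (simp add: GL_def invertible_eq_bij[symmetric] invertible_det_nz)

lemma gen_mat_in_GL: "\<kappa> \<noteq> 0 \<Longrightarrow> (*v) (gen_mat \<kappa> x a) \<in> carrier (GL (*s))"
  by (rule mat_in_GL) (cases a; simp add: sigma_mat_def swap_mat_def det_2 vector_2)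

lemma gen_mat_relations:
  assumes "\<kappa> \<noteq> 0" "(l, r) \<in> LB3_relations"
  shows "eval_word (GL (*s)) (\<lambda>a. (*v) (gen_mat \<kappa> x a)) l =
         eval_word (GL (*s)) (\<lambda>a. (*v) (gen_mat \<kappa> x a)) r"
  using assms(2)
  by (auto simp: LB3_relations_def eval_word_def GL_def fun_eq_iff sigma_mat_def swap_mat_def
      vec_eq_iff forall_2 matrix_vector_mult_def sum_2 vector_2 algebra_simps)

lemma LB3_mat_rep:
  assumes "\<kappa> \<noteq> 0"
  shows "fd_representation LB3 (*s) (LB3_mat_rep \<kappa> x)"
    and "LB3_mat_rep \<kappa> x (LB3_elem a) = (*v) (gen_mat \<kappa> x a)"
proof -
  note * = presented_lift[of "GL (*s)" "\<lambda>a. (*v) (gen_mat \<kappa> x a)" LB3_relations,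
      OF group_GL[OF vec.vector_space_axioms] gen_mat_in_GL[OF assms]
        gen_mat_relations[OF assms]]
  show "fd_representation LB3 (*s) (LB3_mat_rep \<kappa> x)"
    unfolding fd_representation_def LB3_def LB3_mat_rep_def
    using * vec.finite_dimensional_vector_space_axioms by blast
  show "LB3_mat_rep \<kappa> x (LB3_elem a) = (*v) (gen_mat \<kappa> x a)"
    unfolding LB3_elem_def LB3_mat_rep_def using * by blast
qed

lemma isomorphic_repsI_gen:
  assumes \<kappa>: "\<kappa> \<noteq> 0" and \<mu>: "\<mu> \<noteq> 0" and P: "det P \<noteq> 0"
    and eq: "\<And>a. P ** gen_mat \<kappa> x a = gen_mat \<mu> y a ** P"
  shows "isomorphic_reps LB3 (*s) (LB3_mat_rep \<kappa> x) (*s) (LB3_mat_rep \<mu> y)"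
  unfolding isomorphic_reps_def
proof (intro exI[of _ "(*v) P"] conjI ballI)
  let ?H = "GL (*s) :: (complex^2 \<Rightarrow> complex^2) monoid"
  let ?f = "\<lambda>a. (*v) (gen_mat \<kappa> x a)" and ?g = "\<lambda>a. (*v) (gen_mat \<mu> y a)"
  interpret group ?H by (rule group_GL[OF vec.vector_space_axioms])
  have p: "(*v) P \<in> carrier ?H" by (rule mat_in_GL[OF P])
  then show "Vector_Spaces.linear (*s) (*s) ((*v) P)" "bij ((*v) P)"
    by (auto simp: GL_def)
  have f: "?f a \<in> carrier ?H" and g: "?g a \<in> carrier ?H" for a
    by (simp_all add: gen_mat_in_GL \<kappa> \<mu>)
  have pos: "(*v) P \<otimes>\<^bsub>?H\<^esub> ?f a = ?g a \<otimes>\<^bsub>?H\<^esub> (*v) P" for a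
    using eq[of a] by (simp add: GL_def fun_eq_iff matrix_vector_mul_assoc)
  have neg: "(*v) P \<otimes>\<^bsub>?H\<^esub> inv\<^bsub>?H\<^esub> ?f a = inv\<^bsub>?H\<^esub> ?g a \<otimes>\<^bsub>?H\<^esub> (*v) P" for a
  proof -
    have "(*v) P = inv\<^bsub>?H\<^esub> ?g a \<otimes>\<^bsub>?H\<^esub> (?g a \<otimes>\<^bsub>?H\<^esub> (*v) P)"
      using p g by (simp add: m_assoc[symmetric])
    also have "\<dots> = inv\<^bsub>?H\<^esub> ?g a \<otimes>\<^bsub>?H\<^esub> (*v) P \<otimes>\<^bsub>?H\<^esub> ?f a"
      using p g f by (simp add: m_assoc pos)
    finally show ?thesis
      using p g f by (metis inv_closed inv_solve_right' m_closed)
  qed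
  have *: "(*v) P \<otimes>\<^bsub>?H\<^esub> eval_word ?H ?f w = eval_word ?H ?g w \<otimes>\<^bsub>?H\<^esub> (*v) P" for w
  proof (induction w)
    case Nil
    then show ?case using p by (simp add: eval_word_def)
  next
    case (Cons q w)
    obtain a e where q: "q = (a, e)" by (cases q)
    define F where "F = (if e then inv\<^bsub>?H\<^esub> ?f a else ?f a)"
    define G where "G = (if e then inv\<^bsub>?H\<^esub> ?g a else ?g a)"
    have FG: "F \<in> carrier ?H" "G \<in> carrier ?H" "(*v) P \<otimes>\<^bsub>?H\<^esub> F = G \<otimes>\<^bsub>?H\<^esub> (*v) P"
      unfolding F_def G_def using f g pos neg by auto
    have c: "eval_word ?H ?f w \<in> carrier ?H" "eval_word ?H ?g w \<in> carrier ?H"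
      by (rule eval_word_closed[OF is_group], rule f, rule eval_word_closed[OF is_group], rule g)
    have "eval_word ?H ?f (q # w) = F \<otimes>\<^bsub>?H\<^esub> eval_word ?H ?f w"
      "eval_word ?H ?g (q # w) = G \<otimes>\<^bsub>?H\<^esub> eval_word ?H ?g w"
      by (simp_all add: eval_word_def q F_def G_def)
    then show ?case using Cons FG c p by (metis m_assoc)
  qed
  fix h assume "h \<in> carrier LB3"
  then obtain w where w: "h = word_class LB3_relations w"
    by (auto simp: LB3_def presented_group_def)
  show "(*v) P \<circ> LB3_mat_rep \<kappa> x h = LB3_mat_rep \<mu> y h \<circ> (*v) P"
    using *[of w] presented_lift_word_class[OF is_group f gen_mat_relations[OF \<kappa>], where w = w]
      presented_lift_word_class[OF is_group g gen_mat_relations[OF \<mu>], where w = w]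
    by (simp add: LB3_mat_rep_def w GL_def)
qed

text \<open>The parameters \<open>(\<kappa>, x)\<close> and \<open>(- \<kappa>, x)\<close> yield isomorphic representations whenever
  \<open>x \<noteq> \<plusminus>2\<kappa>\<close>, which is the case in which the representation is irreducible.  So
  non-isomorphism for distinct parameters can only hold up to the sign of \<open>\<kappa>\<close>.\<close>

lemma LB3_mat_rep_uminus:
  assumes "\<kappa> \<noteq> 0" "x \<noteq> 2 * \<kappa>" "x \<noteq> - 2 * \<kappa>"
  shows "isomorphic_reps LB3 (*s) (LB3_mat_rep \<kappa> x) (*s) (LB3_mat_rep (- \<kappa>) x)"
proof (rule isomorphic_repsI_gen)
  let ?P = "vector [vector [x, 2 * \<kappa>], vector [2 * \<kappa>, x]] :: complex^2^2"
  have "det ?P = (x - 2 * \<kappa>) * (x + 2 * \<kappa>)"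
    by (simp add: det_2 vector_2 algebra_simps)
  then show "det ?P \<noteq> 0" using assms(2,3) by (auto simp: add_eq_0_iff2)
  show "?P ** gen_mat \<kappa> x a = gen_mat (- \<kappa>) x a ** ?P" for a
    by (cases a)
      (simp_all add: sigma_mat_def swap_mat_def matrix_matrix_mult_def vec_eq_iff forall_2 sum_2 vector_2)
qed (use assms in auto)

end

theory Submission
  imports Defs "HOL-Computational_Algebra.Fundamental_Theorem_Algebra"
begin

text \<open>If \<open>s\<^sub>1 s\<^sub>2\<close> acts trivially, the relations say that \<open>\<sigma>\<^sub>1, \<sigma>\<^sub>2\<close> act by one operator \<open>A\<close>,
  that \<open>s\<^sub>1, s\<^sub>2\<close> act by one involution \<open>S\<close>, and that \<open>A\<^sup>2\<close> commutes with \<open>S\<close>.  By Schur's lemma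
  \<open>A\<^sup>2\<close> is a scalar; hence \<open>A S + S A\<close> commutes with \<open>A\<close> and \<open>S\<close> and is a scalar \<open>x\<close> as well.
  If \<open>A v = \<kappa> v\<close> then \<open>A S v = x v - \<kappa> S v\<close>, so \<open>v\<close> and \<open>S v\<close> span an invariant subspace and
  form the required basis.  Conversely, an intertwiner of two of the matrix representations
  commutes with the swap, so it has the form \<open>((a, b), (b, a))\<close>, and comparing entries shows that
  the parameters agree up to the sign of \<open>\<kappa>\<close>.\<close>

section \<open>Eigenvectors and Schur's lemma\<close>

text \<open>Split off a root \<open>z\<close>, so that \<open>p = (X - z) q\<close>, and put
  \<open>w = q(T) v\<close>. Either \<open>w\<close> is nonzero and an eigenvector for
  \<open>z\<close>, or \<open>q\<close> annihilates \<open>v\<close> and the induction continues.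
  The bound \<open>n\<close> lets \<open>p(T) v\<close> be written as a plain sum.\<close>

lemma eigenvector_of_annihilating_poly:
  fixes smul :: "complex \<Rightarrow> 'v::ab_group_add \<Rightarrow> 'v"
  assumes T: "Vector_Spaces.linear smul smul T" and "v \<noteq> 0"
  shows "p \<noteq> 0 \<Longrightarrow> degree p \<le> n \<Longrightarrow> (\<Sum>i\<le>n. smul (coeff p i) ((T ^^ i) v)) = 0 \<Longrightarrow>
    \<exists>z w. w \<noteq> 0 \<and> T w = smul z w"
proof (induction n arbitrary: p)
  interpret T: Vector_Spaces.linear smul smul T by fact
  case 0
  then have "coeff p 0 \<noteq> 0" by (metis le_zero_eq leading_coeff_0_iff)
  with 0 show ?case using \<open>v \<noteq> 0\<close> by simp
next
  interpret T: Vector_Spaces.linear smul smul T by fact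
  case (Suc n)
  show ?case
  proof (cases "degree p = 0")
    case True
    then have "coeff p i = 0" if "i > 0" for i using that by (simp add: coeff_eq_0)
    then have "(\<Sum>i\<le>n. smul (coeff p i) ((T ^^ i) v)) = 0"
      using Suc.prems(3) by simp
    then show ?thesis using Suc True by simp
  next
    case False
    then obtain z where "poly p z = 0"
      using fundamental_theorem_of_algebra[of p] constant_degree[of p] by auto
    then obtain q where p: "p = [:- z, 1:] * q" by (auto simp: poly_eq_0_iff_dvd)
    then have "q \<noteq> 0" using Suc.prems(1) by auto
    then have dq: "degree q \<le> n"
      using Suc.prems(2) p degree_mult_eq[of "[:- z, 1:]" q] by simp
    define w where "w = (\<Sum>i\<le>n. smul (coeff q i) ((T ^^ i) v))"
    have q: "coeff q (Suc n) = 0" using dq by (simp add: coeff_eq_0)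
    \<comment> \<open>Multiplying by \<open>X - z\<close> shifts the coefficients of
      \<open>q\<close> and subtracts \<open>z\<close> times them, so the vanishing sum becomes
      \<open>T w - z w\<close>.\<close>
    have "coeff p i = coeff (pCons 0 q) i - z * coeff q i" for i
      by (simp add: p)
    then have "0 = (\<Sum>i\<le>Suc n. smul (coeff (pCons 0 q) i) ((T ^^ i) v)) -
        (\<Sum>i\<le>Suc n. smul (z * coeff q i) ((T ^^ i) v))"
      using Suc.prems(3) by (simp only: T.vs1.scale_left_diff_distrib sum_subtractf)
    also have "(\<Sum>i\<le>Suc n. smul (coeff (pCons 0 q) i) ((T ^^ i) v)) = T w"
      by (subst sum.atMost_Suc_shift) (simp add: w_def T.sum T.scale)
    also have "(\<Sum>i\<le>Suc n. smul (z * coeff q i) ((T ^^ i) v)) = smul z w"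
      by (simp add: q w_def T.vs1.scale_sum_right)
    finally have "T w = smul z w" by simp
    then show ?thesis
      using Suc.IH[OF \<open>q \<noteq> 0\<close> dq] w_def by (cases "w = 0") auto
  qed
qed

text \<open>With \<open>n\<close> the dimension, the \<open>n + 1\<close> vectors
  \<open>v, T v, ..., T^n v\<close> are linearly dependent, which gives a nonzero polynomial
  annihilating \<open>v\<close>.\<close>

lemma eigenvector_exists:
  fixes smul :: "complex \<Rightarrow> 'v::ab_group_add \<Rightarrow> 'v" and v :: 'v
  assumes "finite_dimensional_vector_space smul B"
    and T: "Vector_Spaces.linear smul smul T" and v: "v \<noteq> 0"
  obtains z w where "w \<noteq> 0" "T w = smul z w"
proof -
  interpret finite_dimensional_vector_space smul B by fact
  define n where "n = dim (UNIV :: 'v set)"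
  define f where "f i = (T ^^ i) v" for i
  have "\<exists>p. p \<noteq> 0 \<and> degree p \<le> n \<and> (\<Sum>i\<le>n. smul (coeff p i) (f i)) = 0"
  proof (cases "inj_on f {..n}")
    case True
    have "dependent (f ` {..n})"
    proof (rule dependent_biggerset_general)
      show "dim (f ` {..n}) < card (f ` {..n})"
        using dim_subset[of "f ` {..n}" UNIV] card_image[OF True] unfolding n_def by simp
    qed
    then obtain u w where w: "w \<in> f ` {..n}" "u w \<noteq> 0" and "(\<Sum>w\<in>f ` {..n}. smul (u w) w) = 0"
      by (auto simp: dependent_finite)
    then have s: "(\<Sum>i\<le>n. smul (u (f i)) (f i)) = 0"
      by (simp add: sum.reindex[OF True])
    define p where "p = (\<Sum>i\<le>n. monom (u (f i)) i)"
    have c: "coeff p i = (if i \<le> n then u (f i) else 0)" for i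
      by (simp add: p_def coeff_sum)
    have "p \<noteq> 0" using w c by (metis atMost_iff coeff_0 imageE)
    moreover have "degree p \<le> n" by (rule degree_le) (simp add: c)
    ultimately show ?thesis using s by (intro exI[of _ p]) (simp add: c)
  next
    case False
    then obtain i j where ij: "i \<le> n" "j \<le> n" "i \<noteq> j" "f i = f j"
      by (auto simp: inj_on_def)
    \<comment> \<open>Since \<open>dependent\<close> speaks of sets, it does not see a repetition
      among the iterates. Here \<open>T^i v = T^j v\<close>, so \<open>X^i - X^j\<close> annihilates
      \<open>v\<close>.\<close>
    define p where "p = monom (1::complex) i - monom 1 j"
    have "coeff p i = 1" using ij by (simp add: p_def)
    then have "p \<noteq> 0" by auto
    moreover have "degree p \<le> n" using ij by (intro degree_le) (auto simp: p_def)
    moreover have "(\<Sum>k\<le>n. smul (coeff p k) (f k)) =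
        (\<Sum>k\<le>n. (if i = k then f k else 0) - (if j = k then f k else 0))"
      by (rule sum.cong) (auto simp: p_def)
    then have "(\<Sum>k\<le>n. smul (coeff p k) (f k)) = 0"
      using ij by (simp add: sum_subtractf)
    ultimately show ?thesis by blast
  qed
  then show ?thesis
    using eigenvector_of_annihilating_poly[OF T v] that unfolding f_def by blast
qed

text \<open>An eigenspace of \<open>T\<close> is preserved by everything that commutes with
  \<open>T\<close>, so irreducibility makes it the whole space. A family \<open>F\<close> in place
  of a group suits the application to two operators.\<close>

lemma schur_scalar:
  fixes smul :: "complex \<Rightarrow> 'v::ab_group_add \<Rightarrow> 'v"
  assumes "finite_dimensional_vector_space smul B"
    and nz: "(UNIV :: 'v set) \<noteq> {0}"
    and F: "\<And>f. f \<in> F \<Longrightarrow> Vector_Spaces.linear smul smul f"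
    and irr: "\<And>W. module.subspace smul W \<Longrightarrow> (\<And>f. f \<in> F \<Longrightarrow> f ` W \<subseteq> W) \<Longrightarrow> W = {0} \<or> W = UNIV"
    and T: "Vector_Spaces.linear smul smul T" and comm: "\<And>f. f \<in> F \<Longrightarrow> T \<circ> f = f \<circ> T"
  obtains z where "\<And>v. T v = smul z v"
proof -
  interpret finite_dimensional_vector_space smul B by fact
  interpret T: Vector_Spaces.linear smul smul T by fact
  obtain v :: 'v where "v \<noteq> 0" using nz by auto
  then obtain z w where w: "w \<noteq> 0" "T w = smul z w"
    using eigenvector_exists[OF assms(1) T] by blast
  define W where "W = {v. T v = smul z v}"
  have "subspace W"
    by (rule subspaceI) (auto simp: W_def T.add T.scale scale_right_distrib scale_left_commute)
  moreover have "f ` W \<subseteq> W" if "f \<in> F" for f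
  proof -
    interpret f: Vector_Spaces.linear smul smul f by (rule F[OF that])
    show ?thesis
      using comm[OF that] by (auto simp: W_def fun_eq_iff f.scale)
  qed
  ultimately have "W = {0} \<or> W = UNIV" by (rule irr)
  with w have "W = UNIV" by (auto simp: W_def)
  then show ?thesis using that[of z] by (auto simp: W_def)
qed

section \<open>Representations of presented groups\<close>

text \<open>An injective map preserves dimension, so the image is a subspace of \<open>W\<close> of
  full dimension. This makes \<open>W\<close> stable under the inverse of \<open>f\<close> as
  well.\<close>

lemma (in finite_dimensional_vector_space) bij_linear_image_invariant_subspace:
  assumes "subspace W" "Vector_Spaces.linear scale scale f" "bij f" "f ` W \<subseteq> W"
  shows "f ` W = W"
proof -
  interpret finite_dimensional_vector_space_pair_1 scale Basis scale ..
  interpret f: Vector_Spaces.linear scale scale f by fact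
  have "dim (f ` W) = dim W"
    by (rule dim_image_eq) (use assms in \<open>auto simp: bij_def intro: inj_on_subset\<close>)
  then show ?thesis
    using assms f.subspace_image by (intro subspace_dim_equal) auto
qed

text \<open>A word acts as the composite of its letters, and an inverse letter preserves
  \<open>W\<close> because its generator maps \<open>W\<close> onto \<open>W\<close>, by finite
  dimension.\<close>

lemma presented_rep_invariant:
  assumes B: "finite_dimensional_vector_space smul B"
    and \<rho>: "\<rho> \<in> hom (presented_group R) (GL smul)"
    and W: "module.subspace smul W"
    and gen: "\<And>a. \<rho> (word_class R [(a, False)]) ` W \<subseteq> W"
    and g: "g \<in> carrier (presented_group R)"
  shows "\<rho> g ` W \<subseteq> W"
proof -
  interpret finite_dimensional_vector_space smul B by fact
  have car: "word_class R u \<in> carrier (presented_group R)" for u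
    by (simp add: presented_group_def)
  have mult: "\<rho> (word_class R (u @ v)) = \<rho> (word_class R u) \<circ> \<rho> (word_class R v)" for u v
    using hom_mult[OF \<rho> car car] by (simp add: presented_group_mult GL_def)
  have GL: "Vector_Spaces.linear smul smul (\<rho> (word_class R u))" "bij (\<rho> (word_class R u))" for u
    using hom_in_carrier[OF \<rho> car] by (auto simp: GL_def)
  have one: "\<rho> (word_class R []) = id"
  proof -
    have "\<rho> \<one>\<^bsub>presented_group R\<^esub> = \<one>\<^bsub>GL smul\<^esub>"
      by (rule hom_one[OF \<rho> group_presented_group group_GL]) unfold_locales
    then show ?thesis by (simp add: presented_group_def GL_def)
  qed
  have letter: "\<rho> (word_class R [(a, e)]) ` W \<subseteq> W" for a e
  proof (cases e)
    case True
    have "word_class R [(a, True), (a, False)] = word_class R []"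
      using word_cong.cancel[of R "[]" a True "[]"] by (simp add: word_class_eq_iff)
    then have "\<rho> (word_class R [(a, True)]) \<circ> \<rho> (word_class R [(a, False)]) = id"
      using mult[of "[(a, True)]" "[(a, False)]"] one by simp
    moreover have "\<rho> (word_class R [(a, False)]) ` W = W"
      by (rule bij_linear_image_invariant_subspace[OF W GL gen])
    ultimately have "\<rho> (word_class R [(a, True)]) ` W = id ` W"
      by (metis image_comp)
    then show ?thesis using True by simp
  qed (use gen in simp)
  have "\<rho> (word_class R u) ` W \<subseteq> W" for u
  proof (induction u)
    case Nil
    then show ?case by (simp add: one)
  next
    case (Cons p u)
    have "\<rho> (word_class R (p # u)) ` W = \<rho> (word_class R [p]) ` \<rho> (word_class R u) ` W"
      using mult[of "[p]" u] by (simp add: image_comp)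
    also have "\<dots> \<subseteq> \<rho> (word_class R [p]) ` W" by (rule image_mono[OF Cons])
    also have "\<dots> \<subseteq> W" using letter[of "fst p" "snd p"] by simp
    finally show ?case .
  qed
  then show ?thesis using g by (auto simp: presented_group_def)
qed

section \<open>The loop braid group\<close>

text \<open>The linear algebra with the group removed: \<open>A\<close> stands for the common action
  of \<open>\<sigma>\<^sub>1\<close> and \<open>\<sigma>\<^sub>2\<close>, and \<open>S\<close> for
  that of \<open>s\<^sub>1\<close> and \<open>s\<^sub>2\<close>. Injectivity of \<open>A\<close>
  excludes the eigenvalue 0.\<close>

lemma irreducible_pair_basis:
  fixes smul :: "complex \<Rightarrow> 'v::ab_group_add \<Rightarrow> 'v"
  assumes B: "finite_dimensional_vector_space smul B"
    and A: "Vector_Spaces.linear smul smul A" and S: "Vector_Spaces.linear smul smul S"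
    and "inj A" and SS: "\<And>v. S (S v) = v" and AAS: "\<And>v. A (A (S v)) = S (A (A v))"
    and irr: "\<And>W. module.subspace smul W \<Longrightarrow> A ` W \<subseteq> W \<Longrightarrow> S ` W \<subseteq> W \<Longrightarrow> W = {0} \<or> W = UNIV"
    and dim: "vector_space.dim smul (UNIV :: 'v set) > 1"
  obtains \<kappa> x and b :: "2 \<Rightarrow> 'v" where "vector_space.dim smul (UNIV :: 'v set) = 2" "\<kappa> \<noteq> 0"
    "ordered_basis smul b" "has_matrix smul b A (sigma_mat \<kappa> x)" "has_matrix smul b S swap_mat"
proof -
  interpret finite_dimensional_vector_space smul B by fact
  interpret pair: vector_space_pair smul smul ..
  interpret A: Vector_Spaces.linear smul smul A by fact
  interpret S: Vector_Spaces.linear smul smul S by fact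
  have nz: "(UNIV :: 'v set) \<noteq> {0}" using dim dim_singleton[of 0] by force
  have scalar: "\<exists>z. \<forall>v. T v = smul z v"
    if T: "Vector_Spaces.linear smul smul T" "T \<circ> A = A \<circ> T" "T \<circ> S = S \<circ> T" for T
  proof -
    obtain z where "\<And>v. T v = smul z v"
      by (rule schur_scalar[OF B nz, of "{A, S}" T]) (use A S irr T in auto)
    then show ?thesis by blast
  qed
  have "Vector_Spaces.linear smul smul (A \<circ> A)"
    by (rule Vector_Spaces.linear_compose[OF A A])
  moreover have "A \<circ> A \<circ> S = S \<circ> (A \<circ> A)" by (simp add: fun_eq_iff AAS)
  ultimately obtain c where c: "\<And>v. A (A v) = smul c v"
    using scalar[of "A \<circ> A"] by (auto simp: comp_assoc)
  have "Vector_Spaces.linear smul smul (\<lambda>v. A (S v) + S (A v))"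
    using pair.linear_compose_add[OF Vector_Spaces.linear_compose[OF S A]
        Vector_Spaces.linear_compose[OF A S]]
    by (simp add: comp_def)
  \<comment> \<open>Both products equal \<open>A S A + c S\<close> because \<open>A^2 = c\<close>;
    likewise both products with \<open>S\<close> equal \<open>A + S A S\<close> because
    \<open>S^2 = 1\<close>.\<close>
  moreover have "(\<lambda>v. A (S v) + S (A v)) \<circ> A = A \<circ> (\<lambda>v. A (S v) + S (A v))"
    by (simp add: fun_eq_iff A.add c S.scale)
  moreover have "(\<lambda>v. A (S v) + S (A v)) \<circ> S = S \<circ> (\<lambda>v. A (S v) + S (A v))"
    by (simp add: fun_eq_iff S.add SS)
  ultimately obtain x where x: "\<And>v. A (S v) + S (A v) = smul x v"
    using scalar[of "\<lambda>v. A (S v) + S (A v)"] by auto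
  obtain v0 :: 'v where "v0 \<noteq> 0" using nz by auto
  then obtain \<kappa> v where v: "v \<noteq> 0" and Av: "A v = smul \<kappa> v"
    by (rule eigenvector_exists[OF B A])
  have "\<kappa> \<noteq> 0"
    using v Av \<open>inj A\<close> by (metis A.zero injD scale_zero_left)
  \<comment> \<open>This is the second column of \<open>sigma_mat\<close>; the eigenvector equation
    for \<open>v\<close> is the first.\<close>
  have ASv: "A (S v) = smul x v - smul \<kappa> (S v)"
    using x[of v] by (simp add: Av S.scale eq_diff_eq)
  have gen: "v \<in> span {v, S v}" "S v \<in> span {v, S v}" by (auto intro: span_base)
  have "A ` span {v, S v} \<subseteq> span {v, S v}"
    unfolding A.span_image[symmetric]
    by (rule span_minimal) (use gen in \<open>auto simp: Av ASv intro: span_scale span_diff\<close>)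
  moreover have "S ` span {v, S v} \<subseteq> span {v, S v}"
    unfolding S.span_image[symmetric]
    by (rule span_minimal) (use gen in \<open>auto simp: SS\<close>)
  ultimately have "span {v, S v} = {0} \<or> span {v, S v} = UNIV"
    by (intro irr subspace_span)
  with gen v have span: "span {v, S v} = UNIV" by auto
  \<comment> \<open>At most two vectors span a space of dimension above 1, so they are distinct, the
    dimension is 2, and a spanning set of that size is independent.\<close>
  have "dim (UNIV :: 'v set) \<le> card {v, S v}"
    by (rule span_card_ge_dim) (auto simp: span)
  moreover have "card {v, S v} \<le> 2" by (simp add: card_insert_if)
  ultimately have card: "card {v, S v} = 2" "dim (UNIV :: 'v set) = 2"
    using dim by linarith+
  have ind: "independent {v, S v}"
    by (rule card_le_dim_spanning[of _ UNIV]) (simp_all only: span card subset_UNIV order_refl finite.intros)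
  \<comment> \<open>The elements of the index type \<open>2\<close> are 1 and 2, so the second
    branch is the case of index 2.\<close>
  define b :: "2 \<Rightarrow> 'v" where "b i = (if i = 1 then v else S v)" for i
  have b: "b 1 = v" "b 2 = S v" by (auto simp: b_def)
  have range: "range b = {v, S v}" by (auto simp: b_def UNIV_2)
  have "v \<noteq> S v" using card by auto
  then have "inj b" by (auto simp: inj_def b forall_2)
  then have "ordered_basis smul b" by (simp add: ordered_basis_def range ind span)
  moreover have "has_matrix smul b A (sigma_mat \<kappa> x)"
    by (simp add: has_matrix_def forall_2 sum_2 sigma_mat_def b Av ASv)
  moreover have "has_matrix smul b S swap_mat"
    by (simp add: has_matrix_def forall_2 sum_2 swap_mat_def b SS)
  ultimately show ?thesis using card(2) \<open>\<kappa> \<noteq> 0\<close> that by blast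
qed

section \<open>From the group relations to the pair\<close>

text \<open>Turns a defining relation into an identity of operators; for concrete words
  \<open>foldr\<close> unfolds to explicit compositions.\<close>

lemma LB3_rep_relation:
  assumes \<rho>: "\<rho> \<in> hom LB3 (GL smul)" and V: "vector_space smul"
    and rel: "(gen_word l, gen_word r) \<in> LB3_relations"
  shows "foldr (\<lambda>a f. \<rho> (LB3_elem a) \<circ> f) l id = foldr (\<lambda>a f. \<rho> (LB3_elem a) \<circ> f) r id"
proof -
  have word: "\<rho> (word_class LB3_relations (gen_word w)) = foldr (\<lambda>a f. \<rho> (LB3_elem a) \<circ> f) w id" for w
  proof (induction w)
    case Nil
    have "\<rho> \<one>\<^bsub>LB3\<^esub> = \<one>\<^bsub>GL smul\<^esub>"
      using \<rho> by (rule hom_one) (simp_all add: LB3_def group_presented_group group_GL V)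
    then show ?case by (simp add: LB3_def presented_group_def GL_def)
  next
    case (Cons a w)
    have "word_class LB3_relations u \<in> carrier LB3" for u
      by (simp add: LB3_def presented_group_def)
    then have "\<rho> (LB3_elem a \<otimes>\<^bsub>LB3\<^esub> word_class LB3_relations (gen_word w)) =
        \<rho> (LB3_elem a) \<circ> \<rho> (word_class LB3_relations (gen_word w))"
      using hom_mult[OF \<rho>] by (simp add: LB3_elem_def GL_def)
    then show ?case
      using Cons by (simp add: LB3_def LB3_elem_def presented_group_mult)
  qed
  have "word_class LB3_relations (gen_word l) = word_class LB3_relations (gen_word r)"
    using word_cong.rel[OF rel, of "[]" "[]"] by (simp add: word_class_eq_iff)
  then show ?thesis using word by metis
qed

text \<open>Triviality of \<open>s\<^sub>1 s\<^sub>2\<close> and \<open>s\<^sub>2^2 = 1\<close>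
  identify the actions of \<open>s\<^sub>1\<close> and \<open>s\<^sub>2\<close>. The first mixed
  relation then identifies those of \<open>\<sigma>\<^sub>1\<close> and
  \<open>\<sigma>\<^sub>2\<close>, and the second says that the square of this operator commutes
  with the involution.\<close>

lemma irreducible_LB3_rep_basis:
  fixes smul :: "complex \<Rightarrow> 'v::ab_group_add \<Rightarrow> 'v"
  assumes fd: "fd_representation LB3 smul \<rho>" and irr: "irreducible_rep LB3 smul \<rho>"
    and triv: "\<rho> (s\<^sub>1 \<otimes>\<^bsub>LB3\<^esub> s\<^sub>2) = id" and dim: "vector_space.dim smul (UNIV :: 'v set) > 1"
  obtains \<kappa> x and b :: "2 \<Rightarrow> 'v" where "vector_space.dim smul (UNIV :: 'v set) = 2" "\<kappa> \<noteq> 0"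
    "ordered_basis smul b"
    "has_matrix smul b (\<rho> \<sigma>\<^sub>1) (sigma_mat \<kappa> x)" "has_matrix smul b (\<rho> \<sigma>\<^sub>2) (sigma_mat \<kappa> x)"
    "has_matrix smul b (\<rho> s\<^sub>1) swap_mat" "has_matrix smul b (\<rho> s\<^sub>2) swap_mat"
proof -
  obtain B where B: "finite_dimensional_vector_space smul B"
    and \<rho>: "\<rho> \<in> hom LB3 (GL smul)"
    using fd by (auto simp: fd_representation_def)
  interpret finite_dimensional_vector_space smul B by (rule B)
  have car: "LB3_elem a \<in> carrier LB3" for a
    by (simp add: LB3_elem_def LB3_def presented_group_def)
  have GL: "Vector_Spaces.linear smul smul (\<rho> (LB3_elem a))" "bij (\<rho> (LB3_elem a))" for a
    using hom_in_carrier[OF \<rho> car] by (auto simp: GL_def)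
  note rel = LB3_rep_relation[OF \<rho> vector_space_axioms]
  have 12: "\<rho> s\<^sub>1 \<circ> \<rho> s\<^sub>2 = id"
    using triv hom_mult[OF \<rho> car car] by (simp add: GL_def)
  have 22: "\<rho> s\<^sub>2 \<circ> \<rho> s\<^sub>2 = id"
    using rel[of "[S2, S2]" "[]"] by (simp add: LB3_relations_def)
  have s: "\<rho> s\<^sub>2 = \<rho> s\<^sub>1" using 12 22 by (metis comp_assoc comp_id id_comp)
  have "\<rho> s\<^sub>1 \<circ> (\<rho> s\<^sub>2 \<circ> \<rho> \<sigma>\<^sub>1) = \<rho> \<sigma>\<^sub>2 \<circ> (\<rho> s\<^sub>1 \<circ> \<rho> s\<^sub>2)"
    using rel[of "[S1, S2, Sigma1]" "[Sigma2, S1, S2]"] by (simp add: LB3_relations_def)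
  then have \<sigma>: "\<rho> \<sigma>\<^sub>2 = \<rho> \<sigma>\<^sub>1" using 12 by (simp add: comp_assoc[symmetric])
  have "\<rho> \<sigma>\<^sub>1 \<circ> (\<rho> \<sigma>\<^sub>2 \<circ> \<rho> s\<^sub>1) = \<rho> s\<^sub>2 \<circ> (\<rho> \<sigma>\<^sub>1 \<circ> \<rho> \<sigma>\<^sub>2)"
    using rel[of "[Sigma1, Sigma2, S1]" "[S2, Sigma1, Sigma2]"] by (simp add: LB3_relations_def)
  then have AAS: "\<rho> \<sigma>\<^sub>1 (\<rho> \<sigma>\<^sub>1 (\<rho> s\<^sub>1 v)) = \<rho> s\<^sub>1 (\<rho> \<sigma>\<^sub>1 (\<rho> \<sigma>\<^sub>1 v))" for v
    by (simp add: s \<sigma> fun_eq_iff)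
  have irr': "W = {0} \<or> W = UNIV" if "subspace W" "\<rho> \<sigma>\<^sub>1 ` W \<subseteq> W" "\<rho> s\<^sub>1 ` W \<subseteq> W" for W
  proof -
    have "\<rho> (LB3_elem a) ` W \<subseteq> W" for a
      by (cases a) (simp_all add: that s \<sigma>)
    then have "\<rho> g ` W \<subseteq> W" if "g \<in> carrier LB3" for g
      using presented_rep_invariant[OF B \<rho>[unfolded LB3_def] \<open>subspace W\<close>] that
      by (simp add: LB3_def LB3_elem_def)
    then show ?thesis using irr \<open>subspace W\<close> by (simp add: irreducible_rep_def)
  qed
  have SS: "\<rho> s\<^sub>1 (\<rho> s\<^sub>1 v) = v" for v
    using 12 by (simp add: s fun_eq_iff)
  obtain \<kappa> x and b :: "2 \<Rightarrow> 'v" where "dim (UNIV :: 'v set) = 2" "\<kappa> \<noteq> 0" "ordered_basis smul b"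
    "has_matrix smul b (\<rho> \<sigma>\<^sub>1) (sigma_mat \<kappa> x)" "has_matrix smul b (\<rho> s\<^sub>1) swap_mat"
    by (rule irreducible_pair_basis[of smul B "\<rho> \<sigma>\<^sub>1" "\<rho> s\<^sub>1",
          OF B GL(1) GL(1) bij_is_inj[OF GL(2)] SS AAS irr' dim])
  then show ?thesis using that[of \<kappa> b x] by (simp add: s \<sigma>)
qed

section \<open>Intertwiners of the matrix representations\<close>

text \<open>The sign ambiguity is genuine, by \<open>LB3_mat_rep_uminus\<close>. In the proof the
  off-diagonal entry of the intertwiner decides the sign: if it vanishes then
  \<open>\<kappa> = \<mu>\<close>, otherwise \<open>\<kappa> = - \<mu>\<close>.\<close>

lemma LB3_mat_rep_isomorphic_imp:
  assumes "\<kappa> \<noteq> 0" "\<mu> \<noteq> 0"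
    and "isomorphic_reps LB3 (*s) (LB3_mat_rep \<kappa> x) (*s) (LB3_mat_rep \<mu> y)"
  shows "x = y" "\<kappa> = \<mu> \<or> \<kappa> = - \<mu>"
proof -
  obtain T where T: "Vector_Spaces.linear (*s) (*s) T" "bij T"
    and eq: "\<And>g. g \<in> carrier LB3 \<Longrightarrow> T \<circ> LB3_mat_rep \<kappa> x g = LB3_mat_rep \<mu> y g \<circ> T"
    using assms(3) unfolding isomorphic_reps_def by blast
  define P where "P = matrix T"
  have P: "P *v v = T v" for v unfolding P_def by (rule matrix_works[OF T(1)])
  have "P ** gen_mat \<kappa> x a = gen_mat \<mu> y a ** P" for a
  proof -
    have "LB3_elem a \<in> carrier LB3"
      by (simp add: LB3_elem_def LB3_def presented_group_def)
    from eq[OF this] have "T (gen_mat \<kappa> x a *v v) = gen_mat \<mu> y a *v T v" for v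
      unfolding LB3_mat_rep(2)[OF assms(1)] LB3_mat_rep(2)[OF assms(2)]
      by (simp only: fun_eq_iff comp_apply)
    then show ?thesis
      by (simp only: matrix_eq P matrix_vector_mul_assoc[symmetric]) simp
  qed
  note eqs = this[unfolded matrix_matrix_mult_def vec_eq_iff forall_2 sum_2]
  have S: "P$1$1 = P$2$2" "P$1$2 = P$2$1"
    using eqs[of S1, unfolded gen_mat.simps swap_mat_def, simplified] by blast+
  \<comment> \<open>The entries (1,1), (1,2), (2,1), (2,2) of the intertwining equation for
    \<open>Sigma1\<close>, in this order.\<close>
  have A: "P$1$1 * \<kappa> = \<mu> * P$1$1 + y * P$2$1" "P$1$1 * x - P$1$2 * \<kappa> = \<mu> * P$1$2 + y * P$2$2"
      "P$2$1 * \<kappa> = - \<mu> * P$2$1" "P$2$1 * x - P$2$2 * \<kappa> = - \<mu> * P$2$2"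
    using eqs[of Sigma1, unfolded gen_mat.simps sigma_mat_def, simplified] by simp_all
  \<comment> \<open>Injectivity of \<open>T\<close> is tested on \<open>1\<close>, the all-ones
    vector.\<close>
  have "P \<noteq> 0"
  proof
    assume "P = 0"
    then have "T 1 = T 0" unfolding P[symmetric] by simp
    then have "(1 :: complex^2) = 0" by (rule injD[OF bij_is_inj[OF T(2)]])
    then show False by (simp add: vec_eq_iff)
  qed
  then have nz: "P$1$1 \<noteq> 0 \<or> P$2$1 \<noteq> 0" using S by (auto simp: vec_eq_iff forall_2)
  show "\<kappa> = \<mu> \<or> \<kappa> = - \<mu>"
  proof (cases "P$2$1 = 0")
    case True
    then show ?thesis using A(1) nz by simp
  next
    case False
    have "P$2$1 * (\<kappa> + \<mu>) = 0" using A(3) by algebra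
    with False show ?thesis by (simp add: eq_neg_iff_add_eq_0)
  qed
  show "x = y"
  proof (cases "P$2$1 = 0")
    case True
    then show ?thesis using A(2) S nz by simp
  next
    case False
    \<comment> \<open>In the sum of the equations for the two diagonal entries, the terms with
      \<open>\<kappa>\<close> and \<open>\<mu>\<close> cancel because
      \<open>P$1$1 = P$2$2\<close>.\<close>
    have "P$2$1 * x = P$2$1 * y" using A(1,4) S by algebra
    with False show ?thesis by simp
  qed
qed

theorem theorem2p7:
  "(\<forall>(smul :: complex \<Rightarrow> 'v::ab_group_add \<Rightarrow> 'v) \<rho>.
      fd_representation LB3 smul \<rho> \<and> irreducible_rep LB3 smul \<rho> \<and>
      \<rho> (s\<^sub>1 \<otimes>\<^bsub>LB3\<^esub> s\<^sub>2) = id \<and> vector_space.dim smul (UNIV :: 'v set) > 1 \<longrightarrow>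
      vector_space.dim smul (UNIV :: 'v set) = 2 \<and>
      (\<exists>\<kappa> x. \<kappa> \<noteq> 0 \<and>
         (\<exists>b :: 2 \<Rightarrow> 'v. ordered_basis smul b \<and>
            has_matrix smul b (\<rho> \<sigma>\<^sub>1) (sigma_mat \<kappa> x) \<and>
            has_matrix smul b (\<rho> \<sigma>\<^sub>2) (sigma_mat \<kappa> x) \<and>
            has_matrix smul b (\<rho> s\<^sub>1) swap_mat \<and>
            has_matrix smul b (\<rho> s\<^sub>2) swap_mat))) \<and>
   (\<forall>\<kappa> x \<mu> y. \<kappa> \<noteq> 0 \<and> \<mu> \<noteq> 0 \<and> (\<kappa>, x) \<noteq> (\<mu>, y) \<and> (\<kappa>, x) \<noteq> (- \<mu>, y) \<longrightarrow>
      \<not> isomorphic_reps LB3 (*s) (LB3_mat_rep \<kappa> x) (*s) (LB3_mat_rep \<mu> y))"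
\<comment> \<open>The instantiation confines \<open>conjI\<close> to the outer conjunction, which
  leaves one case for the classification and one for non-isomorphism.\<close>
proof (intro conjI[where P = "\<forall>smul \<rho>. _ smul \<rho>"] allI impI, goal_cases)
  case (1 smul \<rho>)
  then show ?case by (elim conjE irreducible_LB3_rep_basis) blast+
next
  case (2 \<kappa> x \<mu> y)
  then show ?case using LB3_mat_rep_isomorphic_imp[of \<kappa> \<mu> x y] by auto
qed

end
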